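(* Let $(Y,\nu)$ be a probability space, $S:Y\to Y$ an ergodic $\nu$-preserving transformation, $G$ an infinite countable discrete metric group with identity $e$ that is at most $d$-dimensional, and $f:Y\to G$ a measurable function. Denote $$\lambda=\limsup_{n\to\infty}\frac{\log\left(\operatorname{ess\,sup}_{y\in Y}\left\|\prod_{i=0}^{n-1}f(S^iy)\right\|\right)}{\log n}.$$ If $1/d>\lambda$ and the skew product $T(y,g)=(S(y),g\cdot f(y))$ on $X=Y\times G$ is ergodic with respect to the product $\mu$ of $\nu$ and the counting measure on $G$, then for every $\lambda'$ with $1/d>\lambda'>\lambda$ the skew product $(X,\mu,T)$ is $\omega$-recurrent for $\omega(n)=n^{d\lambda'-1}$.
   Context: Products are ordered: $\prod_{i=0}^{n-1}f(S^iy)=f(y)\cdot f(Sy)\cdots f(S^{n-1}y)$. For a discrete metric group $G$, $\|g\|$ denotes the distance from $g$ to the identity. $G$ is called at most $d$-dimensional ($d>0$) if $\#\{g\in G:\|g\|\le n\}\in O(n^d)$. The number $\lambda$ is called the principal Lyapunov exponent. For a nonincreasing, regularly varying $\omega:\mathbb{R}^+\to\mathbb{R}^+$ (regularly varying: $\omega(kx)\asymp\omega(x)$ for every $k\in\mathbb{R}^+$), a set $A\subset X$ with $0<\mu(A)<\infty$ and $x\in X$, put $\zeta(x)=\sum_{i}\chi_A(T^ix)\,\omega(i)$, summed over $i\ge 0$ (over $i\ge1$ if $\omega(0)$ is not defined). When $T$ is conservative and ergodic, $\zeta$ is either finite almost everywhere or infinite almost everywhere, independently of the choice of $A$ of positive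 finite measure. The system is called $\omega$-recurrent if $\zeta(x)=\infty$ for $\mu$-almost every $x$. *)

theory Defs
  imports "HOL-Algebra.Group" "HOL-Probability.Probability"
begin

section \<open>Ergodic theory on (possibly infinite) measure spaces\<close>

definition measure_preserving_map :: "'a measure \<Rightarrow> ('a \<Rightarrow> 'a) \<Rightarrow> bool" where
  "measure_preserving_map M T \<longleftrightarrow> T \<in> M \<rightarrow>\<^sub>M M \<and> distr M M T = M"

definition ergodic_map :: "'a measure \<Rightarrow> ('a \<Rightarrow> 'a) \<Rightarrow> bool" where
  "ergodic_map M T \<longleftrightarrow> T \<in> M \<rightarrow>\<^sub>M M \<and>
     (\<forall>A \<in> sets M. T -` A \<inter> space M = A \<longrightarrow> A \<in> null_sets M \<or> space M - A \<in> null_sets M)"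

text \<open>Every wandering set is null.\<close>

definition conservative_map :: "'a measure \<Rightarrow> ('a \<Rightarrow> 'a) \<Rightarrow> bool" where
  "conservative_map M T \<longleftrightarrow> T \<in> M \<rightarrow>\<^sub>M M \<and>
     (\<forall>W \<in> sets M. disjoint_family (\<lambda>n::nat. (T ^^ n) -` W \<inter> space M) \<longrightarrow> W \<in> null_sets M)"

section \<open>Recurrence with respect to a weight\<close>

text \<open>A weight is a function on the positive reals; its values elsewhere are irrelevant.\<close>

definition regularly_varying :: "(real \<Rightarrow> real) \<Rightarrow> bool" where
  "regularly_varying \<omega> \<longleftrightarrow> (\<forall>k>0. (\<lambda>x. \<omega> (k * x)) \<in> \<Theta>[at_top](\<omega>))"

definition recurrence_weight :: "(real \<Rightarrow> real) \<Rightarrow> bool" where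
  "recurrence_weight \<omega> \<longleftrightarrow> (\<forall>x>0. \<omega> x > 0) \<and> antimono_on {0<..} \<omega> \<and> regularly_varying \<omega>"

text \<open>The sum starts at time 1, so that \<open>\<omega> 0\<close> is never used.  Where \<open>\<omega> 0\<close> does make
  sense, the omitted term is finite and does not affect divergence.\<close>

definition weighted_visits ::
    "('a \<Rightarrow> 'a) \<Rightarrow> (real \<Rightarrow> real) \<Rightarrow> 'a set \<Rightarrow> 'a \<Rightarrow> ennreal" where
  "weighted_visits T \<omega> A x =
     (\<Sum>i. indicator A ((T ^^ Suc i) x) * ennreal (\<omega> (real (Suc i))))"

text \<open>The notion is meant for conservative ergodic systems and admissible weights, which is made
  part of the definition.  For these, divergence does not depend on the choice of \<open>A\<close>, and it
  is demanded for every \<open>A\<close>.\<close>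

definition omega_recurrent :: "'a measure \<Rightarrow> ('a \<Rightarrow> 'a) \<Rightarrow> (real \<Rightarrow> real) \<Rightarrow> bool" where
  "omega_recurrent M T \<omega> \<longleftrightarrow>
     conservative_map M T \<and> ergodic_map M T \<and> recurrence_weight \<omega> \<and>
     (\<forall>A \<in> sets M. 0 < emeasure M A \<and> emeasure M A < \<infinity> \<longrightarrow>
        (AE x in M. weighted_visits T \<omega> A x = \<infinity>))"

section \<open>Discrete metric groups\<close>

text \<open>No invariance of the metric is required.  Continuity of the group operations is automatic,
  because the topology is discrete.\<close>

locale discrete_metric_group = group G + Metric_space "carrier G" \<delta>
  for G (structure) and \<delta> :: "'g \<Rightarrow> 'g \<Rightarrow> real" +
  assumes discrete: "mtopology = discrete_topology (carrier G)"

definition group_norm :: "('g, 'm) monoid_scheme \<Rightarrow> ('g \<Rightarrow> 'g \<Rightarrow> real) \<Rightarrow> 'g \<Rightarrow> real" where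
  "group_norm G \<delta> g = \<delta> g \<one>\<^bsub>G\<^esub>"

text \<open>Finiteness of the balls is part of the growth condition and has to be stated, since
  \<open>card\<close> is 0 on infinite sets.\<close>

definition at_most_dimensional ::
    "real \<Rightarrow> ('g, 'm) monoid_scheme \<Rightarrow> ('g \<Rightarrow> 'g \<Rightarrow> real) \<Rightarrow> bool" where
  "at_most_dimensional d G \<delta> \<longleftrightarrow>
     (\<forall>n::nat. finite {g \<in> carrier G. group_norm G \<delta> g \<le> real n}) \<and>
     (\<lambda>n::nat. real (card {g \<in> carrier G. group_norm G \<delta> g \<le> real n})) \<in> O(\<lambda>n. real n powr d)"

section \<open>Skew products\<close>

text \<open>\<open>ordered_prod G a n\<close> is \<open>a 0 \<cdot> a 1 \<cdots> a (n - 1)\<close>, in this order.\<close>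

primrec ordered_prod :: "('g, 'm) monoid_scheme \<Rightarrow> (nat \<Rightarrow> 'g) \<Rightarrow> nat \<Rightarrow> 'g" where
  "ordered_prod G a 0 = \<one>\<^bsub>G\<^esub>"
| "ordered_prod G a (Suc n) = ordered_prod G a n \<otimes>\<^bsub>G\<^esub> a n"

definition skew_measure :: "'y measure \<Rightarrow> ('g, 'm) monoid_scheme \<Rightarrow> ('y \<times> 'g) measure" where
  "skew_measure Y G = Y \<Otimes>\<^sub>M count_space (carrier G)"

definition skew_map ::
    "('y \<Rightarrow> 'y) \<Rightarrow> ('g, 'm) monoid_scheme \<Rightarrow> ('y \<Rightarrow> 'g) \<Rightarrow> 'y \<times> 'g \<Rightarrow> 'y \<times> 'g" where
  "skew_map S G f = (\<lambda>(y, g). (S y, g \<otimes>\<^bsub>G\<^esub> f y))"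

text \<open>The logarithm on \<open>[0, \<infinity>]\<close> with \<open>log 0 = -\<infinity>\<close> and \<open>log \<infinity> = \<infinity>\<close>; the essential supremum
  below may take both extreme values.\<close>

definition ln_ereal :: "ereal \<Rightarrow> ereal" where
  "ln_ereal x = (if x = \<infinity> then \<infinity> else if x \<le> 0 then - \<infinity> else ereal (ln (real_of_ereal x)))"

definition principal_lyapunov_exponent ::
    "'y measure \<Rightarrow> ('y \<Rightarrow> 'y) \<Rightarrow> ('g, 'm) monoid_scheme \<Rightarrow> ('g \<Rightarrow> 'g \<Rightarrow> real) \<Rightarrow> ('y \<Rightarrow> 'g) \<Rightarrow> ereal"
  where
  "principal_lyapunov_exponent Y S G \<delta> f =
     limsup (\<lambda>n. ln_ereal (esssup Y (\<lambda>y. ereal (group_norm G \<delta>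
                    (ordered_prod G (\<lambda>i. f ((S ^^ i) y)) n)))) / ereal (ln (real n)))"

end

theory Submission
  imports Defs "HOL-Real_Asymp.Real_Asymp"
begin

text \<open>
  Write \<open>\<mu>\<close> for the measure on \<open>X = Y \<times> G\<close>, \<open>\<zeta>\<close> for the weighted
  number of visits to a set, and choose an exponent \<open>l\<close> strictly between the Lyapunov exponent and
  \<open>l'\<close>.  By the definition of the exponent, almost surely the \<open>n\<close>-fold products lie in the
  ball of radius \<open>n\<^sup>l\<close> once \<open>n\<close> is large, and such a ball has only \<open>O(n powr (d * l))\<close>
  elements.

  Take a set \<open>B\<close> of finite positive measure \<open>b\<close> over a single group element \<open>g\<close>.  Its preimages
  \<open>T\<^sup>-\<^sup>i B\<close> for \<open>i < n\<close> all have measure \<open>b\<close>, because \<open>T\<close> preserves \<open>\<mu>\<close>.  Up to null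
  sets and up to boundedly many \<open>i\<close>, they are crowded into the set of the points over
  \<open>g h\<^sup>-\<^sup>1\<close>, where \<open>h\<close> runs over the ball, and this set has measure \<open>O(n powr (d * l))\<close>.
  The Cauchy-Schwarz inequality turns the crowding into overlaps, that is, into returns: on average
  over \<open>k < n\<close>, the intersection of \<open>B\<close> with \<open>T\<^sup>-\<^sup>k B\<close> must have measure at least of order
  \<open>n powr (- d * l)\<close> (lemma \<open>confined_preimages_imp_correlated\<close>).  If \<open>\<zeta>\<close> were bounded on \<open>B\<close>, the sum of
  these measures over \<open>k < n\<close> would be only \<open>O(n powr (1 - d * l'))\<close>
  (lemma \<open>correlations_le_weighted_visits\<close>).
  As \<open>l < l'\<close>, this is a contradiction, so \<open>\<zeta>\<close> is bounded on no non-null \<open>B\<close>.  Cutting an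
  arbitrary set \<open>A\<close> into countably many pieces, according to the group element and to an integer
  bound for \<open>\<zeta>\<close>, gives \<open>\<zeta> = \<infinity>\<close> almost everywhere on \<open>A\<close>
  (lemma \<open>weighted_visits_infinite_on_set\<close>).

  This one fact yields everything else (lemma \<open>omega_recurrentI\<close>).  The map is conservative,
  because a point of a wandering set never returns to it, so that \<open>\<zeta> = 0\<close> there.  The set where
  \<open>\<zeta> = \<infinity>\<close> is \<open>T\<close>-invariant, since the weight changes only by a bounded factor from one time to
  the next; it is not null, so by ergodicity it has full measure.

  The argument needs \<open>l > 0\<close>, because the growth condition says nothing about radii that tend
  to zero, and therefore \<open>l' > 0\<close>.  A negative Lyapunov exponent is impossible for an ergodic
  skew product over an infinite group (lemma \<open>cocycle_not_confined\<close>): the products would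
  eventually stay in a fixed finite set, so the orbits starting over distant group elements would
  stay away from those starting over the identity.
\<close>

section \<open>Measure-preserving maps\<close>

lemma measure_preserving_map_funpow:
  assumes "measure_preserving_map M T"
  shows "measure_preserving_map M (T ^^ n)"
proof (induction n)
  case 0
  then show ?case by (simp add: measure_preserving_map_def distr_id[unfolded id_def] id_def)
next
  case (Suc n)
  have T: "T \<in> M \<rightarrow>\<^sub>M M" "distr M M T = M"
    using assms by (auto simp: measure_preserving_map_def)
  have Tn: "T ^^ n \<in> M \<rightarrow>\<^sub>M M" "distr M M (T ^^ n) = M"
    using Suc by (auto simp: measure_preserving_map_def)
  have "distr M M (T \<circ> T ^^ n) = distr (distr M M (T ^^ n)) M T"
    by (rule distr_distr[OF T(1) Tn(1), symmetric])
  then show ?case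
    using T Tn by (simp add: measure_preserving_map_def measurable_comp[OF Tn(1) T(1)] del: o_apply)
qed

lemma emeasure_vimage_measure_preserving:
  assumes "measure_preserving_map M T" "A \<in> sets M"
  shows "emeasure M (T -` A \<inter> space M) = emeasure M A"
  using assms emeasure_distr[of T M M A] by (simp add: measure_preserving_map_def)

lemma emeasure_two_visits:
  assumes mp: "measure_preserving_map M T" and B: "B \<in> sets M" and "i \<le> j"
  shows "emeasure M {x \<in> space M. (T ^^ i) x \<in> B \<and> (T ^^ j) x \<in> B} =
         emeasure M {x \<in> space M. x \<in> B \<and> (T ^^ (j - i)) x \<in> B}"
proof -
  have mpi: "measure_preserving_map M (T ^^ i)"
    by (rule measure_preserving_map_funpow[OF mp])
  have [measurable]: "\<And>k. T ^^ k \<in> M \<rightarrow>\<^sub>M M"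
    using measure_preserving_map_funpow[OF mp] by (simp add: measure_preserving_map_def)
  note [measurable] = B
  have shift: "(T ^^ (j - i)) ((T ^^ i) x) = (T ^^ j) x" for x
    using \<open>i \<le> j\<close> funpow_add[of "j - i" i T] by simp
  have "{x \<in> space M. (T ^^ i) x \<in> B \<and> (T ^^ j) x \<in> B} =
        (T ^^ i) -` {x \<in> space M. x \<in> B \<and> (T ^^ (j - i)) x \<in> B} \<inter> space M"
    using measurable_space[of "T ^^ i" M M] shift by auto
  then show ?thesis
    by (simp only:) (rule emeasure_vimage_measure_preserving[OF mpi], measurable)
qed

section \<open>Confined preimages force returns\<close>

text \<open>
  The function counting the times \<open>i \<in> I\<close> with \<open>(T ^^ i) x \<in> B\<close> has integral \<open>card I * \<mu> B\<close> and
  lives on \<open>D\<close>, so the Cauchy-Schwarz inequality bounds its second moment from below.  The second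
  moment is a sum over pairs of times, each depending only on the time difference; for a fixed
  first time every difference occurs at most twice.
\<close>

lemma confined_preimages_imp_correlated:
  assumes mp: "measure_preserving_map M T" and B: "B \<in> sets M" and D: "D \<in> sets M"
    and I: "I \<subseteq> {..<n}"
    and confined: "\<And>i. i \<in> I \<Longrightarrow> AE x in M. (T ^^ i) x \<in> B \<longrightarrow> x \<in> D"
  shows "(of_nat (card I) * emeasure M B)\<^sup>2 \<le>
    emeasure M D * (2 * of_nat (card I) *
      (\<Sum>k<n. emeasure M {x \<in> space M. x \<in> B \<and> (T ^^ k) x \<in> B}))"
proof -
  have fin: "finite I" using I finite_subset by blast
  have [measurable]: "\<And>k. T ^^ k \<in> M \<rightarrow>\<^sub>M M"
    using measure_preserving_map_funpow[OF mp] by (simp add: measure_preserving_map_def)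
  note [measurable] = B D
  define \<psi> where "\<psi> x = (\<Sum>i\<in>I. indicator B ((T ^^ i) x) :: ennreal)" for x
  define a where "a k = emeasure M {x \<in> space M. x \<in> B \<and> (T ^^ k) x \<in> B}" for k
  have [measurable]: "\<psi> \<in> borel_measurable M" unfolding \<psi>_def by measurable
  have "(\<integral>\<^sup>+x. indicator B ((T ^^ i) x) \<partial>M) = emeasure M B" for i
  proof -
    have "(\<integral>\<^sup>+x. indicator B ((T ^^ i) x) \<partial>M) = (\<integral>\<^sup>+x. indicator ((T ^^ i) -` B \<inter> space M) x \<partial>M)"
      by (intro nn_integral_cong) (auto simp: indicator_def)
    then show ?thesis
      by (simp add: emeasure_vimage_measure_preserving[OF measure_preserving_map_funpow[OF mp]])
  qed
  then have int: "(\<integral>\<^sup>+x. \<psi> x \<partial>M) = of_nat (card I) * emeasure M B"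
    unfolding \<psi>_def by (subst nn_integral_sum) auto
  have AE: "AE x in M. \<forall>i\<in>I. (T ^^ i) x \<in> B \<longrightarrow> x \<in> D"
    using confined fin by (intro AE_finite_allI) auto
  have int_D: "(\<integral>\<^sup>+x. \<psi> x * indicator D x \<partial>M) = (\<integral>\<^sup>+x. \<psi> x \<partial>M)"
    by (intro nn_integral_cong_AE eventually_mono[OF AE])
       (auto simp: \<psi>_def indicator_def intro!: sum.neutral)
  have row: "(\<Sum>j\<in>I. a (max i j - min i j)) \<le> 2 * (\<Sum>k<n. a k)" if "i \<in> I" for i
  proof -
    have "(\<Sum>j\<in>I. a (max i j - min i j)) =
        (\<Sum>j\<in>{j\<in>I. j \<le> i}. a (i - j)) + (\<Sum>j\<in>{j\<in>I. i < j}. a (j - i))"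
    proof -
      have "I = {j\<in>I. j \<le> i} \<union> {j\<in>I. i < j}" by auto
      then have "(\<Sum>j\<in>I. a (max i j - min i j)) =
        (\<Sum>j\<in>{j\<in>I. j \<le> i}. a (max i j - min i j)) + (\<Sum>j\<in>{j\<in>I. i < j}. a (max i j - min i j))"
        using fin by (subst sum.union_disjoint[symmetric]) auto
      also have "\<dots> = (\<Sum>j\<in>{j\<in>I. j \<le> i}. a (i - j)) + (\<Sum>j\<in>{j\<in>I. i < j}. a (j - i))"
        by (intro arg_cong2[where f = "(+)"] sum.cong) (auto simp: max_def min_def)
      finally show ?thesis .
    qed
    also have "(\<Sum>j\<in>{j\<in>I. j \<le> i}. a (i - j)) = sum a ((\<lambda>j. i - j) ` {j\<in>I. j \<le> i})"
      by (subst sum.reindex) (auto simp: inj_on_def)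
    also have "(\<Sum>j\<in>{j\<in>I. i < j}. a (j - i)) = sum a ((\<lambda>j. j - i) ` {j\<in>I. i < j})"
      by (subst sum.reindex) (auto simp: inj_on_def)
    also have "sum a ((\<lambda>j. i - j) ` {j\<in>I. j \<le> i}) \<le> (\<Sum>k<n. a k)"
      using I that by (intro sum_mono2) auto
    also have "sum a ((\<lambda>j. j - i) ` {j\<in>I. i < j}) \<le> (\<Sum>k<n. a k)"
      using I that by (intro sum_mono2) auto
    finally show ?thesis by (simp add: mult_2 add_mono)
  qed
  have pair: "(\<integral>\<^sup>+x. indicator B ((T ^^ i) x) * indicator B ((T ^^ j) x) \<partial>M) =
      a (max i j - min i j)" for i j
  proof -
    have "(\<integral>\<^sup>+x. indicator B ((T ^^ i) x) * indicator B ((T ^^ j) x) \<partial>M) =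
        (\<integral>\<^sup>+x. indicator {x \<in> space M. (T ^^ min i j) x \<in> B \<and> (T ^^ max i j) x \<in> B} x \<partial>M)"
      by (intro nn_integral_cong) (auto simp: indicator_def min_def max_def)
    then show ?thesis
      by (simp add: a_def emeasure_two_visits[OF mp B])
  qed
  have "(\<integral>\<^sup>+x. \<psi> x ^ 2 \<partial>M) = (\<integral>\<^sup>+x. (\<Sum>i\<in>I. \<Sum>j\<in>I. indicator B ((T ^^ i) x) * indicator B ((T ^^ j) x)) \<partial>M)"
    by (simp add: \<psi>_def power2_eq_square sum_product)
  also have "\<dots> = (\<Sum>i\<in>I. \<Sum>j\<in>I. a (max i j - min i j))"
    by (simp add: nn_integral_sum pair)
  also have "\<dots> \<le> (\<Sum>i\<in>I. 2 * (\<Sum>k<n. a k))"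
    by (intro sum_mono row)
  finally have sq: "(\<integral>\<^sup>+x. \<psi> x ^ 2 \<partial>M) \<le> 2 * of_nat (card I) * (\<Sum>k<n. a k)"
    by (simp add: ac_simps)
  have "(of_nat (card I) * emeasure M B)\<^sup>2 = (\<integral>\<^sup>+x. \<psi> x * indicator D x \<partial>M)\<^sup>2"
    by (simp add: int int_D)
  also have "\<dots> \<le> (\<integral>\<^sup>+x. \<psi> x ^ 2 \<partial>M) * (\<integral>\<^sup>+x. indicator D x ^ 2 \<partial>M)"
    by (intro Cauchy_Schwarz_nn_integral) auto
  also have "(\<integral>\<^sup>+x. indicator D x ^ 2 \<partial>M) = emeasure M D"
  proof -
    have "(indicator D x :: ennreal) ^ 2 = indicator D x" for x by (auto simp: indicator_def)
    then show ?thesis by simp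
  qed
  also have "(\<integral>\<^sup>+x. \<psi> x ^ 2 \<partial>M) * emeasure M D \<le> (2 * of_nat (card I) * (\<Sum>k<n. a k)) * emeasure M D"
    by (intro mult_right_mono sq) auto
  finally show ?thesis by (simp add: a_def ac_simps)
qed

text \<open>
  Integrating \<open>weighted_visits\<close> over \<open>B\<close> gives the sum of the return probabilities with weights
  \<open>\<omega> k\<close>, and each of the weights that occur is at least \<open>\<omega> n\<close>.
\<close>

lemma correlations_le_weighted_visits:
  fixes \<omega> :: "real \<Rightarrow> real"
  assumes T [measurable]: "T \<in> M \<rightarrow>\<^sub>M M" and B [measurable]: "B \<in> sets M"
    and \<omega>: "antimono_on {0<..} \<omega>" "\<And>x. x > 0 \<Longrightarrow> \<omega> x > 0"
    and bounded: "AE x in M. x \<in> B \<longrightarrow> weighted_visits T \<omega> B x \<le> m"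
  shows "ennreal (\<omega> (real n)) * (\<Sum>k\<in>{1..<n}. emeasure M {x \<in> space M. x \<in> B \<and> (T ^^ k) x \<in> B}) \<le>
         m * emeasure M B"
proof -
  have [measurable]: "T ^^ k \<in> M \<rightarrow>\<^sub>M M" for k
    by (induction k) (auto intro: measurable_comp)
  have "ennreal (\<omega> (real n)) * (\<Sum>k\<in>{1..<n}. emeasure M {x \<in> space M. x \<in> B \<and> (T ^^ k) x \<in> B})
      \<le> (\<Sum>k\<in>{1..<n}. ennreal (\<omega> (real k)) * emeasure M {x \<in> space M. x \<in> B \<and> (T ^^ k) x \<in> B})"
    unfolding sum_distrib_left
    by (intro sum_mono mult_right_mono ennreal_leI) (auto intro: monotone_onD[OF \<omega>(1)])
  also have "\<dots> = (\<Sum>k\<in>{1..<n}. \<integral>\<^sup>+x. indicator B x * (indicator B ((T ^^ k) x) * ennreal (\<omega> (real k))) \<partial>M)"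
  proof (intro sum.cong refl)
    fix k
    have "ennreal (\<omega> (real k)) * emeasure M {x \<in> space M. x \<in> B \<and> (T ^^ k) x \<in> B} =
      (\<integral>\<^sup>+x. ennreal (\<omega> (real k)) * indicator {x \<in> space M. x \<in> B \<and> (T ^^ k) x \<in> B} x \<partial>M)"
      by (subst nn_integral_cmult_indicator) auto
    also have "\<dots> = (\<integral>\<^sup>+x. indicator B x * (indicator B ((T ^^ k) x) * ennreal (\<omega> (real k))) \<partial>M)"
      by (intro nn_integral_cong) (auto simp: indicator_def)
    finally show "ennreal (\<omega> (real k)) * emeasure M {x \<in> space M. x \<in> B \<and> (T ^^ k) x \<in> B} =
      (\<integral>\<^sup>+x. indicator B x * (indicator B ((T ^^ k) x) * ennreal (\<omega> (real k))) \<partial>M)" .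
  qed
  also have "\<dots> = (\<integral>\<^sup>+x. indicator B x * (\<Sum>k\<in>{1..<n}. indicator B ((T ^^ k) x) * ennreal (\<omega> (real k))) \<partial>M)"
    unfolding sum_distrib_left by (intro nn_integral_sum[symmetric]) measurable
  also have "\<dots> \<le> (\<integral>\<^sup>+x. m * indicator B x \<partial>M)"
  proof (intro nn_integral_mono_AE eventually_mono[OF bounded])
    fix x assume *: "x \<in> B \<longrightarrow> weighted_visits T \<omega> B x \<le> m"
    have "{1..<n} = Suc ` {..<n-1}"
      by (cases n) (auto simp: image_Suc_lessThan)
    then have "(\<Sum>k\<in>{1..<n}. indicator B ((T ^^ k) x) * ennreal (\<omega> (real k))) =
        (\<Sum>i<n-1. indicator B ((T ^^ Suc i) x) * ennreal (\<omega> (real (Suc i))))"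
      by (simp only: sum.reindex inj_Suc o_def)
    also have "\<dots> \<le> weighted_visits T \<omega> B x"
      unfolding weighted_visits_def by (intro sum_le_suminf) auto
    finally show "indicator B x * (\<Sum>k\<in>{1..<n}. indicator B ((T ^^ k) x) * ennreal (\<omega> (real k)))
        \<le> m * indicator B x"
      using * by (auto simp: indicator_def intro: order_trans)
  qed
  also have "\<dots> = m * emeasure M B"
    by (subst nn_integral_cmult_indicator) auto
  finally show ?thesis .
qed

text \<open>
  With \<open>b\<close> the measure of \<open>B\<close>, the two preceding bounds combine to \<open>n \<omega>(n) / K(n) = O(1 / b)\<close>
  when \<open>b > 0\<close>.  So the preimages being confined to a space of size \<open>o(n \<omega>(n))\<close> rules this out.
\<close>

lemma null_set_if_visits_bounded:
  fixes \<omega> :: "real \<Rightarrow> real" and K :: "nat \<Rightarrow> real" and m :: real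
  assumes mp: "measure_preserving_map M T" and B: "B \<in> sets M" "emeasure M B \<noteq> \<infinity>"
    and \<omega>: "antimono_on {0<..} \<omega>" "\<And>x. x > 0 \<Longrightarrow> \<omega> x > 0"
    and D: "\<And>n. D n \<in> sets M" "\<And>n. n \<ge> N \<Longrightarrow> emeasure M (D n) \<le> ennreal (K n)"
    and confined: "\<And>i n. N \<le> i \<Longrightarrow> i < n \<Longrightarrow> AE x in M. (T ^^ i) x \<in> B \<longrightarrow> x \<in> D n"
    and K: "\<And>n. n \<ge> N \<Longrightarrow> K n > 0"
    and growth: "filterlim (\<lambda>n. real n * \<omega> (real n) / K n) at_top sequentially"
    and bounded: "AE x in M. x \<in> B \<longrightarrow> weighted_visits T \<omega> B x \<le> ennreal m" and "m \<ge> 0"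
  shows "B \<in> null_sets M"
proof (rule ccontr)
  assume "B \<notin> null_sets M"
  define b where "b = measure M B"
  have b: "emeasure M B = ennreal b"
    using B by (simp add: b_def emeasure_eq_ennreal_measure)
  have "b > 0"
    using \<open>B \<notin> null_sets M\<close> B b by (cases "b > 0") (auto simp: null_sets_def ennreal_neg)
  define c where "c = 4 * (\<omega> 1 + m) / b"
  have bound: "real n * \<omega> (real n) / K n \<le> c" if n: "n \<ge> 2 * N + 1" for n
  proof -
    define C where "C = (\<lambda>k. emeasure M {x \<in> space M. x \<in> B \<and> (T ^^ k) x \<in> B})"
    have pos: "\<omega> (real n) > 0" "K n > 0" "\<omega> 1 > 0" using \<omega>(2) K n by auto
    have wn1: "\<omega> (real n) \<le> \<omega> 1"
      using n by (intro monotone_onD[OF \<omega>(1)]) auto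
    have T: "T \<in> M \<rightarrow>\<^sub>M M" using mp by (simp add: measure_preserving_map_def)
    \<comment> \<open>The diagonal term \<open>k = 0\<close> is not a return and is bounded by \<open>\<omega> 1 * b\<close> instead.\<close>
    have "{..<n} = insert 0 {1..<n}" using n by auto
    then have "ennreal (\<omega> (real n)) * (\<Sum>k<n. C k) =
        ennreal (\<omega> (real n)) * C 0 + ennreal (\<omega> (real n)) * (\<Sum>k\<in>{1..<n}. C k)"
      by (simp add: distrib_left)
    also have "C 0 = ennreal b"
    proof -
      have "{x \<in> space M. x \<in> B} = B" using sets.sets_into_space[OF B(1)] by auto
      then show ?thesis by (simp add: C_def b)
    qed
    also have "ennreal (\<omega> (real n)) * (\<Sum>k\<in>{1..<n}. C k) \<le> ennreal m * ennreal b"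
      using correlations_le_weighted_visits[OF T B(1) \<omega> bounded] by (simp add: C_def b)
    also have "ennreal (\<omega> (real n)) * ennreal b + ennreal m * ennreal b
        \<le> ennreal ((\<omega> 1 + m) * b)"
      using \<open>b > 0\<close> \<open>m \<ge> 0\<close> pos wn1
      by (simp add: ennreal_mult[symmetric] ennreal_plus[symmetric] distrib_right
          ennreal_leI mult_right_mono del: ennreal_plus)
    finally have S: "ennreal (\<omega> (real n)) * (\<Sum>k<n. C k) \<le> ennreal ((\<omega> 1 + m) * b)"
      by (simp add: add_left_mono)
    have "{N..<n} \<subseteq> {..<n}" by auto
    then have "(of_nat (n - N) * ennreal b)\<^sup>2 \<le> emeasure M (D n) * (2 * of_nat (n - N) * (\<Sum>k<n. C k))"
      using confined_preimages_imp_correlated[OF mp B(1) D(1), of "{N..<n}" n n] confined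
      by (auto simp: C_def b)
    also have "\<dots> \<le> ennreal (K n) * (2 * of_nat (n - N) * (\<Sum>k<n. C k))"
      using D(2) n by (intro mult_right_mono) auto
    finally have "ennreal (\<omega> (real n)) * (of_nat (n - N) * ennreal b)\<^sup>2 \<le>
        ennreal (\<omega> (real n)) * (ennreal (K n) * (2 * of_nat (n - N) * (\<Sum>k<n. C k)))"
      by (intro mult_left_mono) auto
    also have "\<dots> = ennreal (K n) * (2 * of_nat (n - N)) * (ennreal (\<omega> (real n)) * (\<Sum>k<n. C k))"
      by (simp add: ac_simps)
    also have "\<dots> \<le> ennreal (K n) * (2 * of_nat (n - N)) * ennreal ((\<omega> 1 + m) * b)"
      by (intro mult_left_mono S) auto
    also have "\<dots> = ennreal (K n * (2 * real (n - N)) * ((\<omega> 1 + m) * b))"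
      using pos \<open>b > 0\<close> \<open>m \<ge> 0\<close>
      by (simp add: ennreal_mult ennreal_of_nat_eq_real_of_nat del: of_nat_diff
          flip: ennreal_numeral)
    also have "ennreal (\<omega> (real n)) * (of_nat (n - N) * ennreal b)\<^sup>2 =
        ennreal (\<omega> (real n) * (real (n - N) * b)\<^sup>2)"
      using pos \<open>b > 0\<close> \<open>m \<ge> 0\<close>
      by (simp add: ennreal_mult ennreal_of_nat_eq_real_of_nat power2_eq_square del: of_nat_diff)
    finally have "\<omega> (real n) * (real (n - N) * b)\<^sup>2 \<le> K n * (2 * real (n - N)) * ((\<omega> 1 + m) * b)"
      using pos \<open>b > 0\<close> \<open>m \<ge> 0\<close> by (subst (asm) ennreal_le_iff) auto
    then have "(real (n - N) * b) * (\<omega> (real n) * real (n - N) * b) \<le>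
        (real (n - N) * b) * (K n * 2 * (\<omega> 1 + m))"
      by (simp only: power2_eq_square ac_simps)
    then have "\<omega> (real n) * real (n - N) * b \<le> K n * 2 * (\<omega> 1 + m)"
      using \<open>b > 0\<close> n by (subst (asm) mult_le_cancel_left_pos) auto
    \<comment> \<open>Only the times from \<open>N\<close> on are confined; for \<open>n > 2 * N\<close> they are at least half of all.\<close>
    moreover have "real n / 2 \<le> real (n - N)" using n by linarith
    ultimately have "\<omega> (real n) * (real n / 2) * b \<le> K n * 2 * (\<omega> 1 + m)"
      using pos \<open>b > 0\<close> \<open>m \<ge> 0\<close>
      by (meson less_imp_le mult_left_mono mult_right_mono order_trans)
    then have "(real n * \<omega> (real n)) * b \<le> (4 * (\<omega> 1 + m)) * K n"
      by (simp add: algebra_simps)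
    then show ?thesis
      using pos \<open>b > 0\<close> by (simp add: c_def pos_divide_le_eq pos_le_divide_eq)
  qed
  have "eventually (\<lambda>n. real n * \<omega> (real n) / K n > c) sequentially"
    using growth by (simp add: filterlim_at_top_dense)
  then obtain n where "n \<ge> 2 * N + 1" "real n * \<omega> (real n) / K n > c"
    by (metis (mono_tags) eventually_sequentially le_cases order_trans)
  with bound show False by force
qed

section \<open>From returns to recurrence\<close>

text \<open>
  For large times, regular variation compares \<open>\<omega> x\<close> with \<open>\<omega> (2 * x)\<close>, and \<open>2 * x\<close> is not below
  the integer after \<open>x\<close> when \<open>x\<close> is a positive integer.  The finitely many small times are absorbed into the constant by adding up their ratios.
\<close>

lemma recurrence_weight_comparable:
  assumes "recurrence_weight \<omega>"
  obtains C where "\<And>i::nat. \<omega> (real (Suc i)) \<le> C * \<omega> (real (Suc (Suc i)))" "C \<ge> 0"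
proof -
  have pos: "\<And>x. x > 0 \<Longrightarrow> \<omega> x > 0" and anti: "antimono_on {0<..} \<omega>"
    and rv: "(\<lambda>x. \<omega> (2 * x)) \<in> \<Theta>[at_top](\<omega>)"
    using assms by (auto simp: recurrence_weight_def regularly_varying_def)
  have "\<omega> \<in> O[at_top](\<lambda>x. \<omega> (2 * x))"
    using rv by (simp add: bigtheta_def bigomega_iff_bigo)
  then obtain c where c: "c > 0" "eventually (\<lambda>x. norm (\<omega> x) \<le> c * norm (\<omega> (2 * x))) at_top"
    by (rule landau_o.bigE)
  obtain x0 where x0: "\<And>x. x \<ge> x0 \<Longrightarrow> norm (\<omega> x) \<le> c * norm (\<omega> (2 * x))"
    using c(2) by (auto simp: eventually_at_top_linorder)
  obtain n0 :: nat where n0: "real n0 \<ge> x0" using real_arch_simple by blast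
  define q where "q i = \<omega> (real (Suc i)) / \<omega> (real (Suc (Suc i)))" for i
  have q: "q i > 0" for i by (simp add: q_def pos)
  have "\<omega> (real (Suc i)) \<le> (c + (\<Sum>j<n0. q j)) * \<omega> (real (Suc (Suc i)))" for i
  proof (cases "i < n0")
    case True
    have "q i \<le> (\<Sum>j<n0. q j)"
      using True by (intro member_le_sum) (auto intro: less_imp_le q)
    then have "q i \<le> c + (\<Sum>j<n0. q j)" using c by simp
    then show ?thesis using pos[of "real (Suc (Suc i))"]
      by (simp add: q_def pos_divide_le_eq)
  next
    case False
    have "\<omega> (real (Suc i)) \<le> c * \<omega> (2 * real (Suc i))"
      using x0[of "real (Suc i)"] False n0 pos[of "real (Suc i)"] pos[of "2 * real (Suc i)"] by simp
    also have "\<omega> (2 * real (Suc i)) \<le> \<omega> (real (Suc (Suc i)))"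
      by (intro monotone_onD[OF anti]) auto
    also have "c * \<omega> (real (Suc (Suc i))) \<le> (c + (\<Sum>j<n0. q j)) * \<omega> (real (Suc (Suc i)))"
      using pos[of "real (Suc (Suc i))"] by (intro mult_right_mono) (auto intro!: sum_nonneg less_imp_le[OF q])
    finally show ?thesis using c by simp
  qed
  moreover have "c + (\<Sum>j<n0. q j) \<ge> 0"
    using c by (intro add_nonneg_nonneg sum_nonneg) (auto intro: less_imp_le q)
  ultimately show ?thesis using that by blast
qed

lemma weighted_visits_shift_eq_infinity_iff:
  assumes \<omega>: "recurrence_weight \<omega>"
  shows "weighted_visits T \<omega> A (T x) = \<infinity> \<longleftrightarrow> weighted_visits T \<omega> A x = \<infinity>"
proof -
  obtain C where C: "\<And>i::nat. \<omega> (real (Suc i)) \<le> C * \<omega> (real (Suc (Suc i)))" "C \<ge> 0"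
    using recurrence_weight_comparable[OF \<omega>] by blast
  define u :: "nat \<Rightarrow> ennreal" where "u i = indicator A ((T ^^ Suc i) x)" for i
  define v where "v = (\<Sum>i. u (Suc i) * ennreal (\<omega> (real (Suc (Suc i)))))"
  have Tx: "weighted_visits T \<omega> A (T x) = (\<Sum>i. u (Suc i) * ennreal (\<omega> (real (Suc i))))"
    by (simp add: weighted_visits_def u_def funpow_swap1)
  have "(\<lambda>i. u (Suc i) * ennreal (\<omega> (real (Suc (Suc i))))) sums v"
    unfolding v_def by (intro summable_sums) auto
  then have "(\<lambda>i. u i * ennreal (\<omega> (real (Suc i)))) sums (v + u 0 * ennreal (\<omega> (real (Suc 0))))"
    by (rule sums_Suc)
  then have x: "weighted_visits T \<omega> A x = v + u 0 * ennreal (\<omega> (real (Suc 0)))"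
    by (simp add: weighted_visits_def u_def sums_iff)
  have u0: "u 0 * ennreal (\<omega> (real (Suc 0))) \<noteq> \<infinity>"
    by (auto simp: u_def indicator_def)
  have "v \<le> weighted_visits T \<omega> A (T x)"
    unfolding v_def Tx using \<omega>
    by (intro suminf_le mult_left_mono ennreal_leI)
       (auto simp: recurrence_weight_def intro: monotone_onD)
  moreover have "weighted_visits T \<omega> A (T x) \<le> ennreal C * v"
  proof -
    have "weighted_visits T \<omega> A (T x) \<le> (\<Sum>i. ennreal C * (u (Suc i) * ennreal (\<omega> (real (Suc (Suc i))))))"
      unfolding Tx
    proof (intro suminf_le)
      fix i
      have "ennreal (\<omega> (real (Suc i))) \<le> ennreal C * ennreal (\<omega> (real (Suc (Suc i))))"
        using C(1)[of i] C(2) \<omega> by (simp add: ennreal_mult[symmetric] recurrence_weight_def less_imp_le ennreal_leI)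
      then show "u (Suc i) * ennreal (\<omega> (real (Suc i))) \<le> ennreal C * (u (Suc i) * ennreal (\<omega> (real (Suc (Suc i)))))"
        by (metis mult.left_commute mult_left_mono zero_le)
    qed auto
    then show ?thesis by (simp add: v_def)
  qed
  ultimately show ?thesis
    using u0 by (auto simp: x top_unique ennreal_mult_eq_top_iff)
qed

lemma borel_measurable_weighted_visits:
  assumes [measurable]: "T \<in> M \<rightarrow>\<^sub>M M" "A \<in> sets M"
  shows "weighted_visits T \<omega> A \<in> borel_measurable M"
proof -
  have [measurable]: "T ^^ k \<in> M \<rightarrow>\<^sub>M M" for k
    by (induction k) (auto intro: measurable_comp)
  have "(\<lambda>x. weighted_visits T \<omega> A x) \<in> borel_measurable M"
    unfolding weighted_visits_def by measurable
  then show ?thesis .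
qed

text \<open>
  Conservativity comes from the same hypothesis as divergence: a wandering set has no returns at
  all, so it is null.  From \<open>A\<close>, divergence spreads to the whole space because it is a
  \<open>T\<close>-invariant property.
\<close>

lemma omega_recurrentI:
  assumes erg: "ergodic_map M T" and \<omega>: "recurrence_weight \<omega>"
    and return: "\<And>A. A \<in> sets M \<Longrightarrow> AE x in M. x \<in> A \<longrightarrow> weighted_visits T \<omega> A x = \<infinity>"
  shows "omega_recurrent M T \<omega>"
proof -
  have T [measurable]: "T \<in> M \<rightarrow>\<^sub>M M" using erg by (simp add: ergodic_map_def)
  have "W \<in> null_sets M"
    if W: "W \<in> sets M" and disj: "disjoint_family (\<lambda>n::nat. (T ^^ n) -` W \<inter> space M)" for W
  proof -
    have "weighted_visits T \<omega> W x = 0" if "x \<in> W" for x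
    proof -
      have "(T ^^ Suc i) x \<notin> W" for i
      proof
        assume "(T ^^ Suc i) x \<in> W"
        then have "x \<in> ((T ^^ Suc i) -` W \<inter> space M) \<inter> ((T ^^ 0) -` W \<inter> space M)"
          using that sets.sets_into_space[OF W] by auto
        then show False
          using disjoint_family_onD[OF disj, of "Suc i" 0] by auto
      qed
      then show ?thesis by (simp add: weighted_visits_def del: funpow.simps)
    qed
    with return[OF W] have "AE x in M. x \<notin> W"
      by (auto elim: eventually_mono)
    then show ?thesis using W by (simp add: AE_iff_null_sets)
  qed
  then have cons: "conservative_map M T" by (simp add: conservative_map_def T)
  have "AE x in M. weighted_visits T \<omega> A x = \<infinity>" if A: "A \<in> sets M" "0 < emeasure M A" for A
  proof -
    define F where "F = {x \<in> space M. weighted_visits T \<omega> A x = \<infinity>}"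
    have [measurable]: "weighted_visits T \<omega> A \<in> borel_measurable M"
      by (rule borel_measurable_weighted_visits[OF T A(1)])
    have F: "F \<in> sets M" unfolding F_def by measurable
    have "T -` F \<inter> space M = F"
      using measurable_space[OF T]
      by (auto simp: F_def weighted_visits_shift_eq_infinity_iff[OF \<omega>, simplified])
    then consider "F \<in> null_sets M" | "space M - F \<in> null_sets M"
      using erg F by (auto simp: ergodic_map_def)
    then show ?thesis
    proof cases
      case 1
      then have "AE x in M. x \<notin> F" by (rule AE_not_in)
      with return[OF A(1)] AE_space have "AE x in M. x \<notin> A"
        by eventually_elim (auto simp: F_def)
      then have "A \<in> null_sets M" using A by (simp add: AE_iff_null_sets)
      then show ?thesis using A by auto
    next
      case 2
      then have "AE x in M. x \<notin> space M - F" by (rule AE_not_in)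
      with AE_space show ?thesis by eventually_elim (auto simp: F_def)
    qed
  qed
  then show ?thesis
    using cons erg \<omega> by (auto simp: omega_recurrent_def)
qed

section \<open>Skew products\<close>

locale skew_product = prob_space Y + group G
  for Y :: "'y measure" and G :: "('g, 'm) monoid_scheme" (structure) +
  fixes S :: "'y \<Rightarrow> 'y" and f :: "'y \<Rightarrow> 'g"
  assumes S_preserving: "measure_preserving_map Y S"
    and countable_carrier: "countable (carrier G)"
    and f_measurable [measurable]: "f \<in> Y \<rightarrow>\<^sub>M count_space (carrier G)"
begin

definition cocycle :: "nat \<Rightarrow> 'y \<Rightarrow> 'g" where
  "cocycle n y = ordered_prod G (\<lambda>i. f ((S ^^ i) y)) n"

abbreviation "X \<equiv> skew_measure Y G"
abbreviation "T \<equiv> skew_map S G f"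

sublocale counting: sigma_finite_measure "count_space (carrier G)"
  by (rule sigma_finite_measure_count_space_countable[OF countable_carrier])

lemma S_measurable [measurable]: "S \<in> Y \<rightarrow>\<^sub>M Y"
  using S_preserving by (simp add: measure_preserving_map_def)

lemma funpow_S_measurable [measurable]: "S ^^ n \<in> Y \<rightarrow>\<^sub>M Y"
  using measure_preserving_map_funpow[OF S_preserving] by (simp add: measure_preserving_map_def)

lemma funpow_S_space: "y \<in> space Y \<Longrightarrow> (S ^^ n) y \<in> space Y"
  using measurable_space[OF funpow_S_measurable] .

lemma f_carrier: "y \<in> space Y \<Longrightarrow> f y \<in> carrier G"
  using measurable_space[OF f_measurable] by simp

lemma mult_measurable:
  assumes "a \<in> M \<rightarrow>\<^sub>M count_space (carrier G)" "b \<in> M \<rightarrow>\<^sub>M count_space (carrier G)"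
  shows "(\<lambda>x. a x \<otimes> b x) \<in> M \<rightarrow>\<^sub>M count_space (carrier G)"
proof (rule measurable_compose_countable'[OF _ assms(1) countable_carrier])
  fix g assume "g \<in> carrier G"
  then have "(\<lambda>h. g \<otimes> h) \<in> count_space (carrier G) \<rightarrow>\<^sub>M count_space (carrier G)"
    by auto
  then show "(\<lambda>x. g \<otimes> b x) \<in> M \<rightarrow>\<^sub>M count_space (carrier G)"
    by (rule measurable_compose[OF assms(2)])
qed

lemma cocycle_measurable: "cocycle n \<in> Y \<rightarrow>\<^sub>M count_space (carrier G)"
proof (induction n)
  case 0
  then show ?case by (simp add: cocycle_def[abs_def])
next
  case (Suc n)
  have "(\<lambda>y. cocycle n y \<otimes> f ((S ^^ n) y)) \<in> Y \<rightarrow>\<^sub>M count_space (carrier G)"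
    by (intro mult_measurable Suc) measurable
  then show ?case by (simp add: cocycle_def[abs_def])
qed

lemma cocycle_carrier: "y \<in> space Y \<Longrightarrow> cocycle n y \<in> carrier G"
  using measurable_space[OF cocycle_measurable] by simp

lemma space_X: "space X = space Y \<times> carrier G"
  by (simp add: skew_measure_def space_pair_measure)

lemma skew_map_measurable: "T \<in> X \<rightarrow>\<^sub>M X"
proof -
  have "(\<lambda>x. (S (fst x), snd x \<otimes> f (fst x))) \<in> X \<rightarrow>\<^sub>M X"
    unfolding skew_measure_def
    by (intro measurable_Pair mult_measurable) measurable
  then show ?thesis by (simp add: skew_map_def case_prod_beta')
qed

lemma funpow_skew_map:
  assumes "y \<in> space Y" "g \<in> carrier G"
  shows "(T ^^ n) (y, g) = ((S ^^ n) y, g \<otimes> cocycle n y)"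
proof (induction n)
  case 0
  then show ?case using assms by (simp add: cocycle_def)
next
  case (Suc n)
  then show ?case
    using assms cocycle_carrier[of y n] f_carrier[OF funpow_S_space, of y n]
    by (simp add: skew_map_def cocycle_def m_assoc)
qed

text \<open>
  Over a fixed \<open>y\<close>, the fibre of the preimage of \<open>A\<close> is the fibre of \<open>A\<close> over \<open>S y\<close>, translated
  on the right by the inverse of \<open>f y\<close>, so it has the same number of elements.
\<close>

lemma skew_map_preserving: "measure_preserving_map X T"
proof -
  have "emeasure X (T -` A \<inter> space X) = emeasure X A" if A: "A \<in> sets X" for A
  proof -
    have A': "A \<in> sets (Y \<Otimes>\<^sub>M count_space (carrier G))"
      using A by (simp add: skew_measure_def)
    have TA: "T -` A \<inter> space X \<in> sets (Y \<Otimes>\<^sub>M count_space (carrier G))"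
      using measurable_sets[OF skew_map_measurable A] by (simp add: skew_measure_def)
    define N where "N y = emeasure (count_space (carrier G)) (Pair y -` A)" for y
    have [measurable]: "N \<in> borel_measurable Y"
      unfolding N_def by (rule counting.measurable_emeasure_Pair[OF A'])
    have "emeasure (count_space (carrier G)) (Pair y -` (T -` A \<inter> space X)) = N (S y)"
      if y: "y \<in> space Y" for y
    proof -
      have sub: "Pair (S y) -` A \<subseteq> carrier G"
        using sets.sets_into_space[OF A] by (auto simp: space_X)
      have eq: "Pair y -` (T -` A \<inter> space X) = {g \<in> carrier G. g \<otimes> f y \<in> Pair (S y) -` A}"
        using y by (auto simp: space_X skew_map_def)
      have "bij_betw (\<lambda>g. g \<otimes> f y) (Pair y -` (T -` A \<inter> space X)) (Pair (S y) -` A)"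
        unfolding eq
        by (rule bij_betw_byWitness[where f' = "\<lambda>h. h \<otimes> inv (f y)"])
           (use sub f_carrier[OF y] in \<open>auto simp: m_assoc\<close>)
      then have "card (Pair y -` (T -` A \<inter> space X)) = card (Pair (S y) -` A)"
        "finite (Pair y -` (T -` A \<inter> space X)) = finite (Pair (S y) -` A)"
        by (auto dest: bij_betw_same_card bij_betw_finite)
      moreover have "Pair y -` (T -` A \<inter> space X) \<subseteq> carrier G"
        unfolding eq by auto
      ultimately show ?thesis
        using sub unfolding N_def by (simp only: emeasure_count_space)
    qed
    then have "emeasure X (T -` A \<inter> space X) = (\<integral>\<^sup>+y. N (S y) \<partial>Y)"
      unfolding skew_measure_def counting.emeasure_pair_measure_alt[OF TA[unfolded skew_measure_def]]
      by (intro nn_integral_cong) auto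
    also have "\<dots> = (\<integral>\<^sup>+y. N y \<partial>distr Y Y S)"
      by (intro nn_integral_distr[symmetric]) measurable
    also have "distr Y Y S = Y"
      using S_preserving by (simp add: measure_preserving_map_def)
    also have "(\<integral>\<^sup>+y. N y \<partial>Y) = emeasure X A"
      unfolding skew_measure_def N_def counting.emeasure_pair_measure_alt[OF A'] ..
    finally show ?thesis .
  qed
  then have "distr X X T = X"
    by (intro measure_eqI) (auto simp: emeasure_distr[OF skew_map_measurable])
  then show ?thesis
    by (simp add: measure_preserving_map_def skew_map_measurable)
qed

lemma AE_skew_measure_fst:
  assumes "AE y in Y. P y"
  shows "AE x in X. P (fst x)"
proof -
  obtain N where N: "{y \<in> space Y. \<not> P y} \<subseteq> N" "N \<in> null_sets Y"
    using assms by (auto simp: eventually_ae_filter)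
  have "N \<times> carrier G \<in> null_sets X"
    unfolding skew_measure_def using N(2) by (intro counting.times_in_null_sets1) auto
  then show ?thesis
    by (rule AE_I') (use N in \<open>auto simp: space_X\<close>)
qed

lemma cylinder:
  assumes "finite E" "E \<subseteq> carrier G"
  shows cylinder_sets: "space Y \<times> E \<in> sets X"
    and emeasure_cylinder: "emeasure X (space Y \<times> E) = of_nat (card E)"
proof -
  show "space Y \<times> E \<in> sets X"
    unfolding skew_measure_def using assms by (intro pair_measureI) auto
  show "emeasure X (space Y \<times> E) = of_nat (card E)"
    unfolding skew_measure_def using assms emeasure_space_1
    by (subst counting.emeasure_pair_measure_Times) auto
qed

text \<open>
  If an orbit that starts over \<open>h\<close> is over \<open>g\<close> at time \<open>i\<close>, then \<open>h = g \<otimes> inv c\<close> with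
  \<open>c = cocycle i y\<close>.  Hence the preimages of a set over \<open>g\<close> live over the reflected and
  translated sets \<open>{g \<otimes> inv b | b. b \<in> E n}\<close>, which have no more elements
  than \<open>E n\<close>.
\<close>

lemma weighted_visits_infinite_on_set:
  fixes E :: "nat \<Rightarrow> 'g set"
  assumes \<omega>: "antimono_on {0<..} \<omega>" "\<And>x. x > 0 \<Longrightarrow> \<omega> x > 0"
    and E: "\<And>n. finite (E n)" "\<And>n. E n \<subseteq> carrier G" "\<And>n. E n \<noteq> {}"
    and confined: "\<And>i n. N \<le> i \<Longrightarrow> i < n \<Longrightarrow> AE y in Y. cocycle i y \<in> E n"
    and growth: "filterlim (\<lambda>n. real n * \<omega> (real n) / real (card (E n))) at_top sequentially"
    and A: "A \<in> sets X"
  shows "AE x in X. x \<in> A \<longrightarrow> weighted_visits T \<omega> A x = \<infinity>"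
proof -
  have [measurable]: "weighted_visits T \<omega> A \<in> borel_measurable X"
    by (rule borel_measurable_weighted_visits[OF skew_map_measurable A])
  define B where "B g m = A \<inter> (space Y \<times> {g}) \<inter> {x \<in> space X. weighted_visits T \<omega> A x \<le> ennreal (real m)}"
    for g and m :: nat
  have null: "B g m \<in> null_sets X" if g: "g \<in> carrier G" for g m
  proof -
    define D where "D n = space Y \<times> ((\<lambda>b. g \<otimes> inv b) ` E n)" for n
    have B: "B g m \<in> sets X"
      unfolding B_def using A g by (intro sets.Int cylinder_sets) auto
    have "emeasure X (B g m) \<le> emeasure X (space Y \<times> {g})"
      using g by (intro emeasure_mono cylinder_sets) (auto simp: B_def)
    then have B_fin: "emeasure X (B g m) \<noteq> \<infinity>"
      using g by (auto simp: emeasure_cylinder top_unique)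
    have img: "(\<lambda>b. g \<otimes> inv b) ` E n \<subseteq> carrier G" for n using g E(2)[of n] by auto
    have "emeasure X (D n) \<le> ennreal (real (card (E n)))" for n
      unfolding D_def using E img[of n] card_image_le[OF E(1), of "\<lambda>b. g \<otimes> inv b" n]
      by (subst emeasure_cylinder) (auto simp: ennreal_of_nat_eq_real_of_nat)
    moreover have "D n \<in> sets X" for n
      unfolding D_def using E img by (intro cylinder_sets) auto
    moreover have "AE x in X. (T ^^ i) x \<in> B g m \<longrightarrow> x \<in> D n" if "N \<le> i" "i < n" for i n
      using AE_skew_measure_fst[OF confined[OF that]] AE_space
    proof eventually_elim
      fix x assume x: "cocycle i (fst x) \<in> E n" "x \<in> space X"
      obtain y h where yh: "x = (y, h)" "y \<in> space Y" "h \<in> carrier G"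
        using x by (auto simp: space_X)
      show "(T ^^ i) x \<in> B g m \<longrightarrow> x \<in> D n"
      proof
        assume "(T ^^ i) x \<in> B g m"
        then have "h \<otimes> cocycle i y = g"
          using yh by (auto simp: funpow_skew_map B_def)
        then have "h = g \<otimes> inv (cocycle i y)"
          using yh g cocycle_carrier[of y i] by (metis inv_solve_right)
        then show "x \<in> D n" using x yh by (auto simp: D_def)
      qed
    qed
    moreover have "AE x in X. x \<in> B g m \<longrightarrow> weighted_visits T \<omega> (B g m) x \<le> ennreal (real m)"
    proof (intro AE_I2 impI)
      fix x assume x: "x \<in> B g m"
      have "weighted_visits T \<omega> (B g m) x \<le> weighted_visits T \<omega> A x"
        unfolding weighted_visits_def
        by (intro suminf_le mult_right_mono) (auto simp: B_def indicator_def)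
      then show "weighted_visits T \<omega> (B g m) x \<le> ennreal (real m)"
        using x by (auto simp: B_def)
    qed
    ultimately show ?thesis
      using E by (intro null_set_if_visits_bounded[OF skew_map_preserving B B_fin \<omega>, of D N "\<lambda>n. real (card (E n))"] growth)
        (auto simp: card_gt_0_iff)
  qed
  have "(\<Union>g\<in>carrier G. \<Union>m. B g m) \<in> null_sets X"
    by (intro null_sets_UN' countable_carrier null) auto
  then show ?thesis
  proof (rule AE_I')
    show "{x \<in> space X. \<not> (x \<in> A \<longrightarrow> weighted_visits T \<omega> A x = \<infinity>)} \<subseteq> (\<Union>g\<in>carrier G. \<Union>m. B g m)"
    proof
      fix x assume "x \<in> {x \<in> space X. \<not> (x \<in> A \<longrightarrow> weighted_visits T \<omega> A x = \<infinity>)}"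
      then have x: "x \<in> space X" "x \<in> A" "weighted_visits T \<omega> A x < \<infinity>"
        by (auto simp: less_top)
      obtain m :: nat where "weighted_visits T \<omega> A x < of_nat m"
        using ennreal_Ex_less_of_nat x(3) by auto
      then show "x \<in> (\<Union>g\<in>carrier G. \<Union>m. B g m)"
        using x by (auto simp: B_def space_X ennreal_of_nat_eq_real_of_nat intro: less_imp_le)
    qed
  qed
qed

text \<open>
  The set \<open>Q\<close> of the points whose orbit eventually stays over \<open>E\<close> is invariant, and it contains
  almost all points over the identity, so it would have full measure.  But an orbit
  that starts over \<open>g\<close> can, almost surely, only stay over \<open>E\<close> if \<open>g\<close> is a quotient of two elements of \<open>E\<close>, which leaves
  out some \<open>g\<close>.
\<close>

lemma cocycle_not_confined:
  assumes erg: "ergodic_map X T" and inf: "infinite (carrier G)"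
    and E: "finite E" "E \<subseteq> carrier G"
    and confined: "\<And>n. N \<le> n \<Longrightarrow> AE y in Y. cocycle n y \<in> E"
  shows False
proof -
  have [measurable]: "T ^^ n \<in> X \<rightarrow>\<^sub>M X" for n
    using measure_preserving_map_funpow[OF skew_map_preserving] by (simp add: measure_preserving_map_def)
  have AE: "AE x in X. \<forall>n\<ge>N. cocycle n (fst x) \<in> E"
    using confined by (intro AE_skew_measure_fst) (auto simp: AE_all_countable)
  define Q where "Q = {x \<in> space X. \<exists>k. \<forall>n\<ge>k. (T ^^ n) x \<in> space Y \<times> E}"
  have [measurable]: "space Y \<times> E \<in> sets X" by (rule cylinder_sets[OF E])
  have Q: "Q \<in> sets X" unfolding Q_def by measurable
  have single: "space Y \<times> {g} \<notin> null_sets X" if "g \<in> carrier G" for g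
    using emeasure_cylinder[of "{g}"] that by auto
  have "T x \<in> Q \<longleftrightarrow> x \<in> Q" if "x \<in> space X" for x
  proof -
    have "(\<exists>k. \<forall>n\<ge>k. (T ^^ Suc n) x \<in> space Y \<times> E) \<longleftrightarrow> (\<exists>k. \<forall>n\<ge>k. (T ^^ n) x \<in> space Y \<times> E)"
      by (metis Suc_le_D Suc_le_mono le_SucI)
    then show ?thesis
      using that measurable_space[OF skew_map_measurable that] by (simp add: Q_def funpow_swap1)
  qed
  then have "T -` Q \<inter> space X = Q"
    using sets.sets_into_space[OF Q] by blast
  then consider "Q \<in> null_sets X" | "space X - Q \<in> null_sets X"
    using erg Q by (auto simp: ergodic_map_def)
  then show False
  proof cases
    case 1
    from AE AE_not_in[OF 1] AE_space have "AE x in X. x \<notin> space Y \<times> {\<one>}"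
    proof eventually_elim
      fix x assume *: "\<forall>n\<ge>N. cocycle n (fst x) \<in> E" "x \<notin> Q" "x \<in> space X"
      show "x \<notin> space Y \<times> {\<one>}"
      proof
        assume "x \<in> space Y \<times> {\<one>}"
        then obtain y where y: "x = (y, \<one>)" "y \<in> space Y" by auto
        then have "\<forall>n\<ge>N. (T ^^ n) x \<in> space Y \<times> E"
          using * by (auto simp: funpow_skew_map funpow_S_space cocycle_carrier)
        then show False using * by (auto simp: Q_def)
      qed
    qed
    then show False
      using single[of \<one>] cylinder_sets[of "{\<one>}"] by (simp add: AE_iff_null_sets)
  next
    case 2
    have "finite ((\<lambda>(a, b). a \<otimes> inv b) ` (E \<times> E))" using E by auto
    then obtain g where g: "g \<in> carrier G" "g \<notin> (\<lambda>(a, b). a \<otimes> inv b) ` (E \<times> E)"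
      using inf by (metis finite_subset subsetI)
    from AE AE_not_in[OF 2] AE_space have "AE x in X. x \<notin> space Y \<times> {g}"
    proof eventually_elim
      fix x assume *: "\<forall>n\<ge>N. cocycle n (fst x) \<in> E" "x \<notin> space X - Q" "x \<in> space X"
      show "x \<notin> space Y \<times> {g}"
      proof
        assume "x \<in> space Y \<times> {g}"
        then obtain y where y: "x = (y, g)" "y \<in> space Y" by auto
        obtain k where "\<forall>n\<ge>k. (T ^^ n) x \<in> space Y \<times> E" using * by (auto simp: Q_def)
        then have "g \<otimes> cocycle (max k N) y \<in> E"
          using y g by (metis funpow_skew_map max.cobounded1 mem_Sigma_iff)
        moreover have "cocycle (max k N) y \<in> E" using * y by auto
        moreover have "g = g \<otimes> cocycle (max k N) y \<otimes> inv (cocycle (max k N) y)"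
          using g cocycle_carrier[OF y(2)] by (simp add: m_assoc)
        ultimately show False using g(2) by force
      qed
    qed
    then show False
      using single[OF g(1)] cylinder_sets[of "{g}"] g by (simp add: AE_iff_null_sets)
  qed
qed

end

section \<open>Growth estimates\<close>

lemma esssup_powr_bound:
  fixes h :: "nat \<Rightarrow> 'a \<Rightarrow> real"
  assumes "limsup (\<lambda>n. ln_ereal (esssup M (\<lambda>x. ereal (h n x))) / ereal (ln (real n))) < ereal l"
  obtains N where "\<And>n. n \<ge> N \<Longrightarrow> AE x in M. h n x \<le> real n powr l"
proof -
  have "eventually (\<lambda>n. ln_ereal (esssup M (\<lambda>x. ereal (h n x))) / ereal (ln (real n)) < ereal l) sequentially"
    using assms by (rule Limsup_lessD)
  then obtain N where N: "\<And>n. n \<ge> N \<Longrightarrow> ln_ereal (esssup M (\<lambda>x. ereal (h n x))) / ereal (ln (real n)) < ereal l"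
    by (auto simp: eventually_sequentially)
  \<comment> \<open>The bound 2 makes \<open>ln (real n)\<close> positive.\<close>
  have "AE x in M. h n x \<le> real n powr l" if n: "n \<ge> max N 2" for n
  proof -
    define e where "e = esssup M (\<lambda>x. ereal (h n x))"
    have ln: "ln (real n) > 0" using n by simp
    have "ln_ereal e / ereal (ln (real n)) < ereal l" using N n by (simp add: e_def)
    then have *: "ln_ereal e < ereal (l * ln (real n))"
      using ln by (cases "ln_ereal e") (auto simp: field_simps)
    have "e \<le> ereal (real n powr l)"
    proof (cases e)
      case (real r)
      show ?thesis
      proof (cases "r \<le> 0")
        case True
        then show ?thesis using real by (auto intro: order_trans[OF _ powr_ge_zero])
      next
        case False
        then have "ln r < l * ln (real n)" using * real by (simp add: ln_ereal_def)
        then have "exp (ln r) < exp (l * ln (real n))" by simp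
        then show ?thesis using False real n by (simp add: powr_def)
      qed
    next
      case PInf
      then show ?thesis using * by (simp add: ln_ereal_def)
    qed auto
    have "AE x in M. ereal (h n x) \<le> e" unfolding e_def by (rule esssup_AE)
    then show ?thesis
      by eventually_elim (use \<open>e \<le> ereal (real n powr l)\<close> in \<open>metis ereal_less_eq(3) order_trans\<close>)
  qed
  then show ?thesis using that by blast
qed

lemma recurrence_weight_powr:
  assumes "a \<le> 0"
  shows "recurrence_weight (\<lambda>x. x powr a)"
proof -
  have "antimono_on {0<..} (\<lambda>x::real. x powr a)"
    using assms by (intro monotone_onI) (auto intro: powr_mono2')
  moreover have "(\<lambda>x. (k * x) powr a) \<in> \<Theta>[at_top](\<lambda>x. x powr a)" if "k > 0" for k :: real
  proof -
    have "eventually (\<lambda>x. (k * x) powr a = k powr a * x powr a) at_top"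
      using eventually_ge_at_top[of 0] by eventually_elim (use that in \<open>simp add: powr_mult\<close>)
    then have "(\<lambda>x. (k * x) powr a) \<in> \<Theta>[at_top](\<lambda>x. k powr a * x powr a)"
      by (rule bigthetaI_cong)
    then show ?thesis using that by simp
  qed
  ultimately show ?thesis
    by (simp add: recurrence_weight_def regularly_varying_def)
qed

text \<open>
  The growth condition speaks of integer radii, hence the rounding.  For \<open>l > 0\<close> the radius
  tends to infinity, so that the condition applies, and it is at least 1, so that rounding up
  costs at most a factor 2.
\<close>

lemma card_ball_bound:
  assumes dim: "at_most_dimensional d G \<delta>" and "d > 0" "l > 0"
  obtains C N where "C > 0" "\<And>n. n \<ge> N \<Longrightarrow>
    real (card {g \<in> carrier G. group_norm G \<delta> g \<le> real (nat \<lceil>real n powr l\<rceil>)}) \<le> C * real n powr (d * l)"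
proof -
  define m where "m n = nat \<lceil>real n powr l\<rceil>" for n :: nat
  define k where "k r = real (card {g \<in> carrier G. group_norm G \<delta> g \<le> real r})" for r :: nat
  have "k \<in> O(\<lambda>n. real n powr d)"
    using dim by (simp add: at_most_dimensional_def k_def[abs_def])
  then obtain c where c: "c > 0" "eventually (\<lambda>n. norm (k n) \<le> c * norm (real n powr d)) sequentially"
    by (rule landau_o.bigE)
  have "filterlim (\<lambda>n. real n powr l) at_top sequentially"
    using \<open>l > 0\<close> by real_asymp
  then have "filterlim (\<lambda>n. real (m n)) at_top sequentially"
    by (rule filterlim_at_top_mono) (auto simp: m_def real_nat_ceiling_ge)
  then have "filterlim m sequentially sequentially"
    by (rule filterlim_sequentially_iff_filterlim_real[THEN iffD2])
  then have "eventually (\<lambda>n. norm (k (m n)) \<le> c * norm (real (m n) powr d)) sequentially"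
    using c(2) by (rule eventually_compose_filterlim[rotated])
  then have "eventually (\<lambda>n. k (m n) \<le> (c * 2 powr d) * real n powr (d * l)) sequentially"
    using eventually_ge_at_top[of 1]
  proof eventually_elim
    case (elim n)
    have "1 \<le> real n powr l" using elim \<open>l > 0\<close> by (simp add: ge_one_powr_ge_zero)
    then have "real (m n) \<le> 2 * real n powr l" unfolding m_def by linarith
    then have "real (m n) powr d \<le> (2 * real n powr l) powr d"
      using \<open>d > 0\<close> by (intro powr_mono2) auto
    also have "\<dots> = 2 powr d * real n powr (d * l)"
      by (simp add: powr_mult powr_powr mult.commute)
    finally have "c * real (m n) powr d \<le> c * (2 powr d * real n powr (d * l))"
      using c by simp
    then show ?case using elim by (simp add: k_def)
  qed
  then obtain N where "\<And>n. n \<ge> N \<Longrightarrow> k (m n) \<le> (c * 2 powr d) * real n powr (d * l)"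
    by (auto simp: eventually_sequentially)
  then show ?thesis
    using c by (intro that[of "c * 2 powr d" N]) (auto simp: k_def m_def)
qed

section \<open>Recurrence from the Lyapunov exponent\<close>

theorem corollary2p6:
  fixes Y :: "'y measure" and S :: "'y \<Rightarrow> 'y"
    and G :: "('g, 'm) monoid_scheme" and \<delta> :: "'g \<Rightarrow> 'g \<Rightarrow> real"
    and f :: "'y \<Rightarrow> 'g" and d :: real
  assumes "prob_space Y"
    and "measure_preserving_map Y S" and "ergodic_map Y S"
    and "discrete_metric_group G \<delta>"
    and "infinite (carrier G)" and "countable (carrier G)"
    and "d > 0" and "at_most_dimensional d G \<delta>"
    and "f \<in> Y \<rightarrow>\<^sub>M count_space (carrier G)"
    and "ereal (1 / d) > principal_lyapunov_exponent Y S G \<delta> f"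
    and "ergodic_map (skew_measure Y G) (skew_map S G f)"
  shows "\<forall>l'::real. ereal (1 / d) > ereal l' \<and> ereal l' > principal_lyapunov_exponent Y S G \<delta> f \<longrightarrow>
           omega_recurrent (skew_measure Y G) (skew_map S G f) (\<lambda>x. x powr (d * l' - 1))"
proof (intro allI impI, elim conjE)
  fix l' :: real
  assume l'd: "ereal l' < ereal (1 / d)" and l': "principal_lyapunov_exponent Y S G \<delta> f < ereal l'"
  interpret G: discrete_metric_group G \<delta> by fact
  interpret skew_product Y G S f
    using assms(1,2,6,9) G.group_axioms
    by (simp add: skew_product_def skew_product_axioms_def)
  define Bl where "Bl r = {g \<in> carrier G. group_norm G \<delta> g \<le> real r}" for r :: nat
  have fin: "finite (Bl r)" for r
    using \<open>at_most_dimensional d G \<delta>\<close> by (simp add: Bl_def at_most_dimensional_def)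
  have Bl: "Bl r \<subseteq> carrier G" "\<one>\<^bsub>G\<^esub> \<in> Bl r" for r
    by (auto simp: Bl_def group_norm_def)
  have bound: "\<exists>N. \<forall>n\<ge>N. AE y in Y. group_norm G \<delta> (cocycle n y) \<le> real n powr l"
    if "principal_lyapunov_exponent Y S G \<delta> f < ereal l" for l
    using esssup_powr_bound[OF that[unfolded principal_lyapunov_exponent_def]]
    by (fold cocycle_def) blast
  have in_ball: "AE y in Y. cocycle n y \<in> Bl r"
    if "AE y in Y. group_norm G \<delta> (cocycle n y) \<le> s" "s \<le> real r" for n r s
    using that(1) AE_space
    by eventually_elim (use that(2) cocycle_carrier in \<open>auto simp: Bl_def\<close>)
  \<comment> \<open>Otherwise the exponent is negative, and the products eventually stay in the unit ball.\<close>
  have "l' > 0"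
  proof (rule ccontr)
    assume "\<not> l' > 0"
    then have "principal_lyapunov_exponent Y S G \<delta> f < ereal 0"
      using l' by (auto intro: less_le_trans)
    then obtain N where N: "\<And>n. n \<ge> N \<Longrightarrow> AE y in Y. group_norm G \<delta> (cocycle n y) \<le> real n powr 0"
      using bound by blast
    have "AE y in Y. cocycle n y \<in> Bl 1" if "n \<ge> N" for n
      by (rule in_ball[OF N[OF that]]) simp
    then show False
      using cocycle_not_confined[OF assms(11,5) fin Bl(1)] by blast
  qed
  obtain l where l: "principal_lyapunov_exponent Y S G \<delta> f < ereal l" "0 < l" "l < l'"
  proof -
    have "max (principal_lyapunov_exponent Y S G \<delta> f) 0 < ereal l'"
      using l' \<open>l' > 0\<close> by simp
    then show ?thesis
      using that ereal_dense2 by (metis ereal_less(2) less_ereal.simps(1) max_less_iff_conj)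
  qed
  obtain N where N: "\<And>n. n \<ge> N \<Longrightarrow> AE y in Y. group_norm G \<delta> (cocycle n y) \<le> real n powr l"
    using bound[OF l(1)] by blast
  define E where "E n = Bl (nat \<lceil>real n powr l\<rceil>)" for n
  obtain C M where C: "C > 0" "\<And>n. n \<ge> M \<Longrightarrow> real (card (E n)) \<le> C * real n powr (d * l)"
    using card_ball_bound[OF \<open>at_most_dimensional d G \<delta>\<close> \<open>d > 0\<close> l(2)] unfolding E_def Bl_def by metis
  have card_pos: "card (E n) > 0" for n
    using fin Bl(2) by (fastforce simp: E_def card_gt_0_iff)
  have confined: "AE y in Y. cocycle i y \<in> E n" if "N \<le> i" "i < n" for i n
    unfolding E_def
  proof (rule in_ball[OF N[OF that(1)]])
    have "real i powr l \<le> real n powr l" using that l by (intro powr_mono2) auto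
    then show "real i powr l \<le> real (nat \<lceil>real n powr l\<rceil>)" by linarith
  qed
  have "filterlim (\<lambda>n. real n powr (d * (l' - l)) / C) at_top sequentially"
    using \<open>d > 0\<close> l C by real_asymp
  then have growth: "filterlim (\<lambda>n. real n * real n powr (d * l' - 1) / real (card (E n))) at_top sequentially"
  proof (rule filterlim_at_top_mono)
    show "eventually (\<lambda>n. real n powr (d * (l' - l)) / C \<le>
        real n * real n powr (d * l' - 1) / real (card (E n))) sequentially"
      using eventually_ge_at_top[of "max M 1"]
    proof eventually_elim
      case (elim n)
      have "real n powr (d * (l' - l)) / C = real n powr (d * l') / (C * real n powr (d * l))"
        by (simp add: right_diff_distrib powr_diff)
      also have "\<dots> \<le> real n powr (d * l') / real (card (E n))"
        using C(1) C(2)[of n] elim card_pos[of n] by (intro divide_left_mono) auto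
      also have "real n powr (d * l') = real n * real n powr (d * l' - 1)"
        using elim by (simp add: powr_diff)
      finally show ?case .
    qed
  qed
  have weight: "recurrence_weight (\<lambda>x. x powr (d * l' - 1))"
    using l'd \<open>d > 0\<close> by (intro recurrence_weight_powr) (simp add: field_simps)
  then have weight': "antimono_on {0<..} (\<lambda>x::real. x powr (d * l' - 1))"
    by (simp add: recurrence_weight_def)
  show "omega_recurrent (skew_measure Y G) (skew_map S G f) (\<lambda>x. x powr (d * l' - 1))"
  proof (rule omega_recurrentI[OF assms(11) weight])
    show "AE x in X. x \<in> A \<longrightarrow> weighted_visits T (\<lambda>x. x powr (d * l' - 1)) A x = \<infinity>"
      if "A \<in> sets X" for A
    proof (rule weighted_visits_infinite_on_set[OF weight' _ _ _ _ confined growth that])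
      show "finite (E n)" "E n \<subseteq> carrier G" "E n \<noteq> {}" for n
        using fin Bl(1) card_pos[of n] by (auto simp: E_def)
    qed auto
  qed
qed

end
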